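(* Consider the BDF2 scheme: given $u_h^0,u_h^1\in\mathcal{C}^{per}_{N\times N}$ with $(u_h^1\|\mathbf 1)=(u_h^0\|\mathbf 1)$, for all $n\ge1$ find $(u_h^{n+1},\omega_h^{n+1})\in\mathcal{C}^{per}_{N\times N}\times\mathcal{C}^{per}_{N\times N}$ such that $$\frac{3u_h^{n+1}-4u_h^n+u_h^{n-1}}{2\tau}=\Delta_h\omega_h^{n+1},\qquad \omega_h^{n+1}=F'(u_h^{n+1})+\varepsilon^2[J\circledast\mathbf 1]u_h^{n+1}-\varepsilon^2[J\circledast u_h^{n+1}].$$ There is a constant $C_J>0$, depending on the kernel $J$ but independent of $h$, such that if the time step $\tau>0$ satisfies $\tau\le\frac{2\gamma_0}{C_J\varepsilon^4}$, then the BDF2 scheme has a unique solution.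
   Context: Setting. $\Omega=(0,L)\times(0,L)$, $h=L/N$ with $N\in\mathbb{Z}^+$, and $\varepsilon>0$. The kernel $J:\mathbb{R}^2\to\mathbb{R}$ is $C^\infty$, $\Omega$-periodic ($L$-periodic in each variable) and even ($J(\mathbf x)=J(-\mathbf x)$), with $J*1=\int_\Omega J\,d\mathbf x>0$. $\mathcal{C}^{per}_{N\times N}$ is the finite-dimensional space of real periodic cell-centered grid functions $\phi=(\phi_{i,j})$ (values at $((i-\tfrac12)h,(j-\tfrac12)h)$), extended $N$-periodically in both indices $i,j\in\mathbb{Z}$. $\mathbf 1$ is the constant grid function $1$; products, powers and $F'(u_h)$ are taken componentwise. $(\phi\|\psi)=\sum_{i,j=1}^N\phi_{i,j}\psi_{i,j}$. Discrete Laplacian: $(\Delta_h\phi)_{i,j}=h^{-2}(\phi_{i+1,j}+\phi_{i-1,j}+\phi_{i,j+1}+\phi_{i,j-1}-4\phi_{i,j})$. Discrete convolution: with $J_{k+\frac12,l+\frac12}:=J(kh,lh)$, $[J\circledast\phi]_{i,j}=h^2\sum_{k=1}^N\sum_{l=1}^N J_{k+\frac12,l+\frac12}\,\phi_{i-k,j-l}$. $[J\circledast\mathbf 1]$ is a constant grid function, identified with the number $h^2\sum_{k,l=1}^N J(kh,lh)$. Standing assumption: $\gamma:=\varepsilon^2(J*1)-1>0$ and its discrete analogue $\gamma_0:=\varepsilon^2[J\circledast\mathbf 1]-1>0$. Potential: $F(r)=\frac14(r^2-1)^2$, so $F'(r)=r^3-r$. *)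

theory Defs
  imports "HOL-Analysis.Analysis"
begin

primrec C_k :: "nat \<Rightarrow> ('a::real_normed_vector \<Rightarrow> 'b::real_normed_vector) \<Rightarrow> bool" where
  "C_k 0 f \<longleftrightarrow> continuous_on UNIV f"
| "C_k (Suc k) f \<longleftrightarrow>
     (\<forall>x. f differentiable (at x)) \<and> (\<forall>v. C_k k (\<lambda>x. frechet_derivative f (at x) v))"

definition C_infinity :: "('a::real_normed_vector \<Rightarrow> 'b::real_normed_vector) \<Rightarrow> bool" where
  "C_infinity f \<longleftrightarrow> (\<forall>k. C_k k f)"

definition Omega :: "real \<Rightarrow> (real \<times> real) set" where
  "Omega L = {0<..<L} \<times> {0<..<L}"

definition conv_one :: "real \<Rightarrow> (real \<times> real \<Rightarrow> real) \<Rightarrow> real" where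
  "conv_one L J = (LINT x:Omega L|lborel. J x)"

definition periodic_kernel :: "real \<Rightarrow> (real \<times> real \<Rightarrow> real) \<Rightarrow> bool" where
  "periodic_kernel L J \<longleftrightarrow>
     C_infinity J \<and>
     (\<forall>x y. J (x + L, y) = J (x, y) \<and> J (x, y + L) = J (x, y)) \<and>
     (\<forall>x. J (- x) = J x) \<and>
     conv_one L J > 0"

text \<open>A grid function is indexed by all of \<open>\<int> \<times> \<int>\<close>; \<open>\<phi> i j\<close> is its value at
  the cell centre \<open>((i - 1/2) h, (j - 1/2) h)\<close>.\<close>

type_synonym grid_fun = "int \<Rightarrow> int \<Rightarrow> real"

definition grid_functions :: "nat \<Rightarrow> grid_fun set" where
  "grid_functions N =
     {\<phi>. \<forall>i j. \<phi> (i + int N) j = \<phi> i j \<and> \<phi> i (j + int N) = \<phi> i j}"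

definition grid_inner :: "nat \<Rightarrow> grid_fun \<Rightarrow> grid_fun \<Rightarrow> real" where
  "grid_inner N \<phi> \<psi> = (\<Sum>i=1..int N. \<Sum>j=1..int N. \<phi> i j * \<psi> i j)"

definition grid_one :: grid_fun where
  "grid_one = (\<lambda>i j. 1)"

definition dlaplace :: "real \<Rightarrow> grid_fun \<Rightarrow> grid_fun" where
  "dlaplace h \<phi> = (\<lambda>i j.
     (\<phi> (i + 1) j + \<phi> (i - 1) j + \<phi> i (j + 1) + \<phi> i (j - 1) - 4 * \<phi> i j) / h\<^sup>2)"

definition dconv :: "real \<Rightarrow> nat \<Rightarrow> (real \<times> real \<Rightarrow> real) \<Rightarrow> grid_fun \<Rightarrow> grid_fun" where
  "dconv h N J \<phi> = (\<lambda>i j.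
     h\<^sup>2 * (\<Sum>k=1..int N. \<Sum>l=1..int N.
            J (of_int k * h, of_int l * h) * \<phi> (i - k) (j - l)))"

definition dconv_one :: "real \<Rightarrow> nat \<Rightarrow> (real \<times> real \<Rightarrow> real) \<Rightarrow> real" where
  "dconv_one h N J = h\<^sup>2 * (\<Sum>k=1..int N. \<Sum>l=1..int N. J (of_int k * h, of_int l * h))"

lemma dconv_grid_one: "dconv h N J grid_one i j = dconv_one h N J"
  by (simp add: dconv_def dconv_one_def grid_one_def)

definition pot :: "real \<Rightarrow> real" where
  "pot r = (r\<^sup>2 - 1)\<^sup>2 / 4"

lemma deriv_pot: "deriv pot r = r ^ 3 - r"
proof (rule DERIV_imp_deriv)
  have "((\<lambda>r. (r\<^sup>2 - 1)\<^sup>2 / 4) has_real_derivative r ^ 3 - r) (at r)"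
    by (auto intro!: derivative_eq_intros simp: power2_eq_square power3_eq_cube field_simps)
  then show "(pot has_real_derivative r ^ 3 - r) (at r)"
    by (simp add: pot_def[abs_def])
qed

definition gamma :: "real \<Rightarrow> real \<Rightarrow> (real \<times> real \<Rightarrow> real) \<Rightarrow> real" where
  "gamma \<epsilon> L J = \<epsilon>\<^sup>2 * conv_one L J - 1"

definition gamma0 :: "real \<Rightarrow> real \<Rightarrow> nat \<Rightarrow> (real \<times> real \<Rightarrow> real) \<Rightarrow> real" where
  "gamma0 \<epsilon> h N J = \<epsilon>\<^sup>2 * dconv_one h N J - 1"

text \<open>\<open>u n\<close> is the \<open>n\<close>-th iterate, with \<open>u 0\<close> and \<open>u 1\<close> given; only the values
  \<open>\<omega> n\<close> with \<open>n \<ge> 2\<close> are part of the scheme, so \<open>\<omega> 0\<close> and \<open>\<omega> 1\<close> are unconstrained.\<close>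

definition BDF2_solution ::
  "real \<Rightarrow> nat \<Rightarrow> (real \<times> real \<Rightarrow> real) \<Rightarrow> real \<Rightarrow> real \<Rightarrow> grid_fun \<Rightarrow> grid_fun \<Rightarrow>
   (nat \<Rightarrow> grid_fun) \<Rightarrow> (nat \<Rightarrow> grid_fun) \<Rightarrow> bool" where
  "BDF2_solution h N J \<epsilon> \<tau> u0 u1 u \<omega> \<longleftrightarrow>
     u 0 = u0 \<and> u 1 = u1 \<and>
     (\<forall>n\<ge>1. u (n + 1) \<in> grid_functions N \<and> \<omega> (n + 1) \<in> grid_functions N \<and>
       (\<forall>i j. (3 * u (n + 1) i j - 4 * u n i j + u (n - 1) i j) / (2 * \<tau>)
                = dlaplace h (\<omega> (n + 1)) i j) \<and>
       (\<forall>i j. \<omega> (n + 1) i j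
                = deriv pot (u (n + 1) i j) + \<epsilon>\<^sup>2 * dconv_one h N J * u (n + 1) i j
                  - \<epsilon>\<^sup>2 * dconv h N J (u (n + 1)) i j))"

end

theory Submission
  imports Defs
begin

text \<open>Put \<open>k = 3 / (2 \<tau>)\<close> and \<open>f = (4 u\<^sup>n - u\<^sup>n\<^sup>-\<^sup>1) / 3\<close>; one step of the scheme asks for \<open>u\<close> with
  \<open>k (u - f) = \<Delta> W(u)\<close>, where \<open>W\<close> is the gradient of a discrete energy \<open>E\<close>. Writing
  \<open>u = f + \<Delta> \<psi>\<close>, a solution is a critical point of \<open>k/2 \<parallel>\<nabla>\<psi>\<parallel>\<^sup>2 + E (f + \<Delta> \<psi>)\<close>. The quartic
  potential bounds \<open>E\<close> from below and the gradient controls \<open>\<psi>\<close> up to a constant, so a minimiser exists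
  for every time step. If \<open>u\<close> and \<open>v\<close> are solutions and \<open>d = u - v\<close>, \<open>w = W(u) - W(v)\<close>, then
  \<open>k d = \<Delta> w\<close>; testing with \<open>w\<close> gives
  \<open>- \<parallel>\<nabla>w\<parallel>\<^sup>2 \<ge> k \<gamma>\<^sub>0 \<parallel>d\<parallel>\<^sup>2 - \<epsilon>\<^sup>2 k (J * d, d)\<close>, and \<open>k (J * d, d) = - (J' * d, \<nabla>w)\<close> (\<open>J'\<close> the
  difference quotients of \<open>J\<close>) is absorbed by Young's inequality when
  \<open>\<tau>\<close> is small, which forces \<open>d = 0\<close>.\<close>

section \<open>Sums over one period\<close>

text \<open>A shift by one trades the term \<open>f 1\<close> for \<open>f (N + 1)\<close>, which is
  equal by periodicity; induction on the integer \<open>a\<close> runs in both directions. This is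
  why no boundary terms appear in later summations by parts.\<close>

lemma period_sum_shift:
  fixes f :: "int \<Rightarrow> real"
  assumes "\<And>i. f (i + int N) = f i"
  shows "(\<Sum>i=1..int N. f (i + a)) = (\<Sum>i=1..int N. f i)"
proof -
  have step: "(\<Sum>i=1..int N. g (i + 1)) = (\<Sum>i=1..int N. g i)"
    if "\<And>i. g (i + int N) = g i" for g :: "int \<Rightarrow> real"
  proof (cases "N = 0")
    case False
    have "(\<Sum>i=1..int N. g (i + 1)) = (\<Sum>i=2..int N + 1. g i)"
      by (rule sum.reindex_bij_witness[of _ "\<lambda>i. i - 1" "\<lambda>i. i + 1"]) auto
    also have "\<dots> = (\<Sum>i=2..int N. g i) + g (1 + int N)"
    proof -
      have "{2..int N + 1} = insert (1 + int N) {2..int N}" using False by auto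
      then show ?thesis by simp
    qed
    also have "\<dots> = (\<Sum>i=1..int N. g i)"
    proof -
      have "{1..int N} = insert 1 {2..int N}" using False by auto
      then show ?thesis using that[of 1] by simp
    qed
    finally show ?thesis .
  qed simp
  show ?thesis
  proof (induction a rule: int_induct[where k = 0])
    case base
    show ?case by simp
  next
    case (step1 a)
    have "f (i + int N + a) = f (i + a)" for i
      using assms[of "i + a"] by (simp add: algebra_simps)
    then show ?case using step[of "\<lambda>i. f (i + a)"] step1 by (simp add: algebra_simps)
  next
    case (step2 a)
    have "f (i + int N + (a - 1)) = f (i + (a - 1))" for i
      using assms[of "i + (a - 1)"] by (simp add: algebra_simps)
    then show ?case using step[of "\<lambda>i. f (i + (a - 1))"] step2 by (simp add: algebra_simps)
  qed
qed

lemma period_sum_reflect: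
  fixes f :: "int \<Rightarrow> real"
  assumes "\<And>i. f (i + int N) = f i"
  shows "(\<Sum>i=1..int N. f (- i)) = (\<Sum>i=1..int N. f i)"
proof -
  \<comment> \<open>Reversing the order of summation by \<open>i -> N + 1 - i\<close> turns the
    reflection into a translation.\<close>
  have "(\<Sum>i=1..int N. f (- i)) = (\<Sum>i=1..int N. f (i + (- int N - 1)))"
    by (rule sum.reindex_bij_witness[of _ "\<lambda>i. int N + 1 - i" "\<lambda>i. int N + 1 - i"]) auto
  then show ?thesis using period_sum_shift[of f N, OF assms] by simp
qed

section \<open>Double sums over one period cell\<close>

definition gsum :: "nat \<Rightarrow> grid_fun \<Rightarrow> real" where
  "gsum N f = (\<Sum>i=1..int N. \<Sum>j=1..int N. f i j)"

lemma gsum_add: "gsum N (\<lambda>i j. f i j + g i j) = gsum N f + gsum N g"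
  by (simp add: gsum_def sum.distrib)

lemma gsum_diff: "gsum N (\<lambda>i j. f i j - g i j) = gsum N f - gsum N g"
  by (simp add: gsum_def sum_subtractf)

lemma gsum_minus: "gsum N (\<lambda>i j. - f i j) = - gsum N f"
  by (simp add: gsum_def sum_negf)

lemma gsum_cmult: "gsum N (\<lambda>i j. c * f i j) = c * gsum N f"
  by (simp add: gsum_def sum_distrib_left)

lemma gsum_multc: "gsum N (\<lambda>i j. f i j * c) = gsum N f * c"
  by (simp add: gsum_def sum_distrib_right)

lemma gsum_divide: "gsum N (\<lambda>i j. f i j / c) = gsum N f / c"
  by (simp add: gsum_def sum_divide_distrib)

lemma gsum_const: "gsum N (\<lambda>i j. c) = (real N)\<^sup>2 * c"
  by (simp add: gsum_def power2_eq_square)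

lemmas gsum_linear = gsum_add gsum_diff gsum_minus gsum_cmult gsum_multc gsum_divide

lemma gsum_mono:
  "(\<And>i j. 1 \<le> i \<Longrightarrow> i \<le> int N \<Longrightarrow> 1 \<le> j \<Longrightarrow> j \<le> int N \<Longrightarrow> f i j \<le> g i j) \<Longrightarrow> gsum N f \<le> gsum N g"
  by (auto simp: gsum_def intro!: sum_mono)

lemma gsum_nonneg: "(\<And>i j. 0 \<le> f i j) \<Longrightarrow> 0 \<le> gsum N f"
  by (auto simp: gsum_def intro!: sum_nonneg)

lemma gsum_swap:
  "gsum N (\<lambda>i j. gsum N (\<lambda>k l. F i j k l)) = gsum N (\<lambda>k l. gsum N (\<lambda>i j. F i j k l))"
proof -
  have gsum_pairs: "gsum N f = (\<Sum>p\<in>{1..int N} \<times> {1..int N}. f (fst p) (snd p))" for f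
    by (simp add: gsum_def sum.cartesian_product case_prod_beta)
  show ?thesis unfolding gsum_pairs by (rule sum.swap)
qed

lemma grid_functionsD:
  assumes "f \<in> grid_functions N"
  shows "f (i + int N) j = f i j" "f i (j + int N) = f i j"
  using assms by (auto simp: grid_functions_def)

lemma grid_functionsI:
  "(\<And>i j. f (i + int N) j = f i j) \<Longrightarrow> (\<And>i j. f i (j + int N) = f i j) \<Longrightarrow> f \<in> grid_functions N"
  by (simp add: grid_functions_def)

lemma grid_functions_shift:
  assumes "f \<in> grid_functions N"
  shows "(\<lambda>i j. f (i + a) (j + b)) \<in> grid_functions N"
proof (rule grid_functionsI)
  fix i j
  show "f (i + int N + a) (j + b) = f (i + a) (j + b)"
    using grid_functionsD(1)[OF assms, of "i + a"] by (simp add: ac_simps)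
  show "f (i + a) (j + int N + b) = f (i + a) (j + b)"
    using grid_functionsD(2)[OF assms, of _ "j + b"] by (simp add: ac_simps)
qed

lemma grid_functions_reflect:
  assumes "f \<in> grid_functions N"
  shows "(\<lambda>i j. f (a - i) (b - j)) \<in> grid_functions N"
proof (rule grid_functionsI)
  fix i j
  show "f (a - (i + int N)) (b - j) = f (a - i) (b - j)"
    using grid_functionsD(1)[OF assms, of "a - i - int N"] by (simp add: diff_diff_eq)
  show "f (a - i) (b - (j + int N)) = f (a - i) (b - j)"
    using grid_functionsD(2)[OF assms, of _ "b - j - int N"] by (simp add: diff_diff_eq)
qed

lemma gsum_shift:
  assumes "f \<in> grid_functions N"
  shows "gsum N (\<lambda>i j. f (i + a) (j + b)) = gsum N f"
proof -
  have "gsum N (\<lambda>i j. f (i + a) (j + b)) = (\<Sum>i=1..int N. \<Sum>j=1..int N. f (i + a) j)"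
    unfolding gsum_def
    by (intro sum.cong refl period_sum_shift) (simp add: grid_functionsD[OF assms])
  also have "\<dots> = gsum N f"
    unfolding gsum_def
    by (rule period_sum_shift[where f = "\<lambda>i. \<Sum>j=1..int N. f i j"])
      (simp add: grid_functionsD[OF assms])
  finally show ?thesis .
qed

lemma gsum_reflect:
  assumes "f \<in> grid_functions N"
  shows "gsum N (\<lambda>i j. f (- i) (- j)) = gsum N f"
proof -
  have "gsum N (\<lambda>i j. f (- i) (- j)) = (\<Sum>i=1..int N. \<Sum>j=1..int N. f (- i) j)"
    unfolding gsum_def
    by (intro sum.cong refl period_sum_reflect) (simp add: grid_functionsD[OF assms])
  also have "\<dots> = gsum N f"
    unfolding gsum_def
    by (rule period_sum_reflect[where f = "\<lambda>i. \<Sum>j=1..int N. f i j"])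
      (simp add: grid_functionsD[OF assms])
  finally show ?thesis .
qed

lemma grid_functions_comp2:
  "f \<in> grid_functions N \<Longrightarrow> g \<in> grid_functions N \<Longrightarrow> (\<lambda>i j. H (f i j) (g i j)) \<in> grid_functions N"
  by (simp add: grid_functions_def)

text \<open>The indices \<open>i\<close>, \<open>j\<close> are arbitrary integers, so the period
  cell is first translated to start at \<open>(i, j)\<close>; in that cell the value is one of the
  nonnegative summands.\<close>

lemma le_gsum:
  assumes "f \<in> grid_functions N" "N \<ge> 1" "\<And>i j. 0 \<le> f i j"
  shows "f i j \<le> gsum N f"
proof -
  let ?g = "\<lambda>k l. f (k + (i - 1)) (l + (j - 1))"
  have "?g 1 1 \<le> (\<Sum>l=1..int N. ?g 1 l)"
    by (rule member_le_sum[where f = "?g 1"]) (use assms in auto)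
  also have "\<dots> \<le> gsum N ?g"
    unfolding gsum_def
    by (rule member_le_sum[where f = "\<lambda>k. \<Sum>l=1..int N. ?g k l"])
      (use assms in \<open>auto intro: sum_nonneg\<close>)
  also have "gsum N ?g = gsum N f"
    using gsum_shift[OF assms(1)] .
  finally show ?thesis by simp
qed

lemma gsum_square_eq_0:
  assumes "f \<in> grid_functions N" "N \<ge> 1" "gsum N (\<lambda>i j. (f i j)\<^sup>2) \<le> 0"
  shows "f i j = 0"
proof -
  have "(f i j)\<^sup>2 \<le> gsum N (\<lambda>i j. (f i j)\<^sup>2)"
    by (rule le_gsum) (use assms in \<open>auto simp: grid_functions_def\<close>)
  then show ?thesis using assms(3) by (smt (verit) zero_less_power2)
qed

lemma grid_function_mod:
  assumes "f \<in> grid_functions N"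
  shows "f (i mod int N) (j mod int N) = f i j"
proof -
  have *: "g (i + int N * k) = g i" if "\<And>i. g (i + int N) = g i" for g :: "int \<Rightarrow> real" and i k
  proof (induction k rule: int_induct[where k = 0])
    case base
    show ?case by simp
  next
    case (step1 k)
    then show ?case using that[of "i + int N * k"] by (simp add: algebra_simps)
  next
    case (step2 k)
    then show ?case using that[of "i + int N * (k - 1)"] by (simp add: algebra_simps)
  qed
  have "f i j = f (i mod int N + int N * (i div int N)) (j mod int N + int N * (j div int N))"
    by simp
  also have "\<dots> = f (i mod int N) (j mod int N + int N * (j div int N))"
    by (rule *[where g = "\<lambda>i. f i _"]) (rule grid_functionsD[OF assms])
  also have "\<dots> = f (i mod int N) (j mod int N)"
    by (rule *) (rule grid_functionsD[OF assms])
  finally show ?thesis by simp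
qed

section \<open>Discrete Laplacian and convolution\<close>

text \<open>Forward differences without division by \<open>h\<close>: the discrete Dirichlet form is
  \<open>grad_inner\<close> divided by \<open>h\<^sup>2\<close>.\<close>

definition grad_inner :: "nat \<Rightarrow> grid_fun \<Rightarrow> grid_fun \<Rightarrow> real" where
  "grad_inner N \<phi> \<psi> = gsum N (\<lambda>i j. (\<phi> (i + 1) j - \<phi> i j) * (\<psi> (i + 1) j - \<psi> i j)
     + (\<phi> i (j + 1) - \<phi> i j) * (\<psi> i (j + 1) - \<psi> i j))"

lemma dlaplace_grid:
  assumes "\<phi> \<in> grid_functions N"
  shows "dlaplace h \<phi> \<in> grid_functions N"
  using grid_functionsD[OF grid_functions_shift[OF assms, of 1 0]]
    grid_functionsD[OF grid_functions_shift[OF assms, of "-1" 0]]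
    grid_functionsD[OF grid_functions_shift[OF assms, of 0 1]]
    grid_functionsD[OF grid_functions_shift[OF assms, of 0 "-1"]]
    grid_functionsD[OF assms]
  by (intro grid_functionsI) (simp_all add: dlaplace_def)

text \<open>Discrete Green formula. Expanding both sides leaves products that agree after
  translation by one cell.\<close>

lemma gsum_mult_dlaplace:
  assumes "\<phi> \<in> grid_functions N" "\<psi> \<in> grid_functions N"
  shows "gsum N (\<lambda>i j. \<phi> i j * dlaplace h \<psi> i j) = - grad_inner N \<phi> \<psi> / h\<^sup>2"
proof -
  note per = grid_functions_comp2[OF assms, of "(*)"]
  have g: "(\<lambda>i j. \<phi> i j * \<psi> (i + a) (j + b)) \<in> grid_functions N" for a b
    by (rule grid_functions_comp2[OF assms(1) grid_functions_shift[OF assms(2)]])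
  have "gsum N (\<lambda>i j. \<phi> (i + 1) j * \<psi> (i + 1) j) = gsum N (\<lambda>i j. \<phi> i j * \<psi> i j)"
    "gsum N (\<lambda>i j. \<phi> i (j + 1) * \<psi> i (j + 1)) = gsum N (\<lambda>i j. \<phi> i j * \<psi> i j)"
    "gsum N (\<lambda>i j. \<phi> (i + 1) j * \<psi> i j) = gsum N (\<lambda>i j. \<phi> i j * \<psi> (i - 1) j)"
    "gsum N (\<lambda>i j. \<phi> i (j + 1) * \<psi> i j) = gsum N (\<lambda>i j. \<phi> i j * \<psi> i (j - 1))"
    using gsum_shift[OF per, of 1 0] gsum_shift[OF per, of 0 1]
      gsum_shift[OF g[of "-1" 0], of 1 0] gsum_shift[OF g[of 0 "-1"], of 0 1]
    by simp_all
  then show ?thesis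
    by (simp add: dlaplace_def grad_inner_def gsum_divide algebra_simps gsum_linear
        flip: minus_divide_left)
      (simp add: field_simps gsum_multc[of N "\<lambda>i j. \<phi> i j * \<psi> i j", unfolded mult.assoc])
qed

text \<open>The kernel is an arbitrary array with all scaling factors absorbed, so that differences
  of a kernel are again kernels of the same kind.\<close>

definition conv :: "nat \<Rightarrow> grid_fun \<Rightarrow> grid_fun \<Rightarrow> grid_fun" where
  "conv N c \<phi> = (\<lambda>i j. gsum N (\<lambda>k l. c k l * \<phi> (i - k) (j - l)))"

lemma conv_grid:
  assumes "\<phi> \<in> grid_functions N"
  shows "conv N c \<phi> \<in> grid_functions N"
  using grid_functionsD[OF grid_functions_shift[OF assms, of "- _" "- _"]]
  by (intro grid_functionsI) (simp_all add: conv_def)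

lemma conv_diff: "conv N c (\<lambda>i j. \<phi> i j - \<psi> i j) = (\<lambda>i j. conv N c \<phi> i j - conv N c \<psi> i j)"
  by (simp add: conv_def algebra_simps gsum_linear)

lemma conv_add_cmult:
  "conv N c (\<lambda>i j. \<phi> i j + t * \<psi> i j) = (\<lambda>i j. conv N c \<phi> i j + t * conv N c \<psi> i j)"
  by (simp add: conv_def algebra_simps gsum_add flip: gsum_cmult)

lemma conv_diff_kernel:
  "conv N (\<lambda>k l. c k l - d k l) \<phi> = (\<lambda>i j. conv N c \<phi> i j - conv N d \<phi> i j)"
  by (simp add: conv_def algebra_simps gsum_linear)

text \<open>Translating the summation variables moves a shift from the argument to the kernel. Hence
  differences of a convolution fall on the smooth kernel and not on \<open>\<phi>\<close>.\<close>

lemma conv_shift: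
  assumes "c \<in> grid_functions N" "\<phi> \<in> grid_functions N"
  shows "conv N c \<phi> (i + a) (j + b) = conv N (\<lambda>k l. c (k + a) (l + b)) \<phi> i j"
proof -
  have "(\<lambda>k l. c k l * \<phi> (i + a - k) (j + b - l)) \<in> grid_functions N"
    by (rule grid_functions_comp2[OF assms(1) grid_functions_reflect[OF assms(2)]])
  from gsum_shift[OF this, of a b] show ?thesis
    by (simp add: conv_def)
qed

lemma conv_symmetric:
  assumes c: "c \<in> grid_functions N" and even: "\<And>k l. c (- k) (- l) = c k l"
    and \<phi>: "\<phi> \<in> grid_functions N" and \<psi>: "\<psi> \<in> grid_functions N"
  shows "gsum N (\<lambda>i j. \<phi> i j * conv N c \<psi> i j) = gsum N (\<lambda>i j. \<psi> i j * conv N c \<phi> i j)"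
proof -
  \<comment> \<open>\<open>A\<close> is the correlation of \<open>\<psi>\<close> and
    \<open>\<phi>\<close>. Exchanging the two functions reflects its argument, and the even kernel
    does not see a reflection.\<close>
  define A where "A = (\<lambda>k l. gsum N (\<lambda>i j. \<psi> i j * \<phi> (i - k) (j - l)))"
  have A: "A \<in> grid_functions N"
    using grid_functionsD[OF grid_functions_reflect[OF \<phi>]]
    by (intro grid_functionsI) (simp_all add: A_def)
  have "gsum N (\<lambda>i j. \<phi> i j * conv N c \<psi> i j)
      = gsum N (\<lambda>k l. gsum N (\<lambda>i j. \<phi> i j * (c k l * \<psi> (i - k) (j - l))))"
    unfolding conv_def gsum_cmult[symmetric] by (rule gsum_swap)
  also have "\<dots> = gsum N (\<lambda>k l. c k l * gsum N (\<lambda>i j. \<phi> i j * \<psi> (i - k) (j - l)))"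
    by (simp add: mult.left_commute flip: gsum_cmult)
  also have "\<dots> = gsum N (\<lambda>k l. c (- k) (- l) * A (- k) (- l))"
  proof -
    have "gsum N (\<lambda>i j. \<phi> i j * \<psi> (i - k) (j - l)) = A (- k) (- l)" for k l
      using gsum_shift[OF grid_functions_comp2[OF \<phi> grid_functions_shift[OF \<psi>, of "- k" "- l"]],
          of "(*)" k l]
      by (simp add: A_def mult.commute)
    then show ?thesis by (simp add: even)
  qed
  also have "\<dots> = gsum N (\<lambda>k l. c k l * A k l)"
    by (rule gsum_reflect[OF grid_functions_comp2[OF c A]])
  also have "\<dots> = gsum N (\<lambda>k l. gsum N (\<lambda>i j. \<psi> i j * (c k l * \<phi> (i - k) (j - l))))"
    unfolding A_def by (simp add: mult.left_commute flip: gsum_cmult)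
  also have "\<dots> = gsum N (\<lambda>i j. \<psi> i j * conv N c \<phi> i j)"
    unfolding conv_def gsum_cmult[symmetric] by (rule gsum_swap)
  finally show ?thesis .
qed

text \<open>Young's inequality for products, applied pointwise for every kernel index and then
  summed; translating \<open>\<psi>\<close> does not change its norm. The weight \<open>s\<close>
  stays free so that it can be tuned to the gradient terms.\<close>

lemma conv_bound:
  assumes \<psi>: "\<psi> \<in> grid_functions N" and s: "s > 0"
  shows "gsum N (\<lambda>i j. \<phi> i j * conv N c \<psi> i j)
    \<le> gsum N (\<lambda>k l. \<bar>c k l\<bar>)
        * (s / 2 * gsum N (\<lambda>i j. (\<phi> i j)\<^sup>2) + gsum N (\<lambda>i j. (\<psi> i j)\<^sup>2) / (2 * s))"
proof -
  have young: "p * (c k l * q) \<le> \<bar>c k l\<bar> * (s / 2 * p\<^sup>2 + q\<^sup>2 / (2 * s))" for p q k l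
  proof -
    have "0 \<le> (s * \<bar>p\<bar> - \<bar>q\<bar>)\<^sup>2 / (2 * s)" using s by simp
    also have "\<dots> = s / 2 * p\<^sup>2 + q\<^sup>2 / (2 * s) - \<bar>p\<bar> * \<bar>q\<bar>"
      using s by (simp add: power2_diff power_mult_distrib field_simps power2_eq_square)
    finally have "\<bar>p\<bar> * \<bar>q\<bar> \<le> s / 2 * p\<^sup>2 + q\<^sup>2 / (2 * s)" by simp
    then have "\<bar>c k l\<bar> * (\<bar>p\<bar> * \<bar>q\<bar>) \<le> \<bar>c k l\<bar> * (s / 2 * p\<^sup>2 + q\<^sup>2 / (2 * s))"
      by (rule mult_left_mono) simp
    moreover have "p * (c k l * q) \<le> \<bar>c k l\<bar> * (\<bar>p\<bar> * \<bar>q\<bar>)"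
      using abs_ge_self[of "p * (c k l * q)"] by (simp add: abs_mult algebra_simps)
    ultimately show ?thesis by linarith
  qed
  have "gsum N (\<lambda>i j. \<phi> i j * conv N c \<psi> i j)
      = gsum N (\<lambda>k l. gsum N (\<lambda>i j. \<phi> i j * (c k l * \<psi> (i - k) (j - l))))"
    unfolding conv_def gsum_cmult[symmetric] by (rule gsum_swap)
  also have "\<dots> \<le> gsum N (\<lambda>k l. gsum N (\<lambda>i j.
      \<bar>c k l\<bar> * (s / 2 * (\<phi> i j)\<^sup>2 + (\<psi> (i - k) (j - l))\<^sup>2 / (2 * s))))"
    by (intro gsum_mono young)
  also have "\<dots> = gsum N (\<lambda>k l. \<bar>c k l\<bar> *
      (s / 2 * gsum N (\<lambda>i j. (\<phi> i j)\<^sup>2) + gsum N (\<lambda>i j. (\<psi> i j)\<^sup>2) / (2 * s)))"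
  proof -
    have "(\<lambda>i j. (\<psi> i j)\<^sup>2) \<in> grid_functions N"
      using \<psi> by (simp add: grid_functions_def)
    from gsum_shift[OF this, of "- _" "- _"] show ?thesis
      by (simp only: gsum_cmult gsum_add gsum_divide diff_conv_add_uminus)
  qed
  finally show ?thesis by (simp only: gsum_multc)
qed

section \<open>Uniqueness of one step\<close>

lemma grad_inner_self:
  "grad_inner N w w = gsum N (\<lambda>i j. (w (i + 1) j - w i j)\<^sup>2) + gsum N (\<lambda>i j. (w i (j + 1) - w i j)\<^sup>2)"
  by (simp add: grad_inner_def gsum_add power2_eq_square)

text \<open>\<open>B\<close> bounds the l1 norm of the difference quotients of \<open>c\<close> in
  each direction. Testing the difference of the two equations leaves
  \<open>2 * k * (a - 1) - B\<^sup>2\<close> times the squared norm of \<open>d\<close> at most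
  zero.\<close>

lemma implicit_step_unique:
  fixes a k :: real
  assumes N: "N \<ge> 1" and h: "h > 0" and B: "B > 0" and k: "k > 0"
    and c: "c \<in> grid_functions N"
    and c1: "gsum N (\<lambda>k l. \<bar>c (k + 1) l - c k l\<bar>) \<le> B * h"
    and c2: "gsum N (\<lambda>k l. \<bar>c k (l + 1) - c k l\<bar>) \<le> B * h"
    and small: "B\<^sup>2 < 2 * k * (a - 1)"
    and u: "u \<in> grid_functions N" and v: "v \<in> grid_functions N"
    and eu: "\<And>i j. k * (u i j - f i j) = dlaplace h (\<lambda>i j. deriv pot (u i j) + a * u i j - conv N c u i j) i j"
    and ev: "\<And>i j. k * (v i j - f i j) = dlaplace h (\<lambda>i j. deriv pot (v i j) + a * v i j - conv N c v i j) i j"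
  shows "u = v"
proof -
  define d where "d = (\<lambda>i j. u i j - v i j)"
  define w where "w = (\<lambda>i j. ((deriv pot (u i j) - deriv pot (v i j)) + a * d i j) - conv N c d i j)"
  have d: "d \<in> grid_functions N" using u v by (simp add: d_def grid_functions_def)
  have cd: "conv N c d \<in> grid_functions N" by (rule conv_grid[OF d])
  have w: "w \<in> grid_functions N" using u v d cd by (simp add: w_def grid_functions_def)
  have kd: "k * d i j = dlaplace h w i j" for i j
    using eu[of i j] ev[of i j] unfolding d_def w_def conv_diff dlaplace_def
    by (simp add: field_simps diff_divide_distrib add_divide_distrib)
  let ?D = "gsum N (\<lambda>i j. (d i j)\<^sup>2)"
  let ?G = "grad_inner N w w"
  have dw: "k * gsum N (\<lambda>i j. w i j * d i j) = - ?G / h\<^sup>2"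
    using gsum_mult_dlaplace[OF w w, of h] by (simp add: mult.left_commute flip: kd gsum_cmult)
  \<comment> \<open>This weight in Young's inequality makes the gradient terms cancel exactly.\<close>
  define s where "s = 2 / (B * h)"
  have s: "s > 0" using B h by (simp add: s_def)
  \<comment> \<open>The equation \<open>k d = dlaplace h w\<close> is used a second time, now inside
    the nonlocal term; Green's formula then pairs differences of the convolution with those of
    \<open>w\<close>.\<close>
  have cdd: "k * gsum N (\<lambda>i j. conv N c d i j * d i j) = - grad_inner N (conv N c d) w / h\<^sup>2"
    using gsum_mult_dlaplace[OF cd w, of h] by (simp add: mult.left_commute flip: kd gsum_cmult)
  \<comment> \<open>The difference of \<open>w\<close> is reversed to absorb the minus sign of
    Green's formula; its square, and so the bound, is unchanged.\<close>
  have D1: "gsum N (\<lambda>i j. (w i j - w (i + 1) j) * conv N (\<lambda>k l. c (k + 1) l - c k l) d i j)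
      \<le> B * h * (s / 2 * gsum N (\<lambda>i j. (w (i + 1) j - w i j)\<^sup>2) + ?D / (2 * s))"
    by (rule order_trans[OF conv_bound[OF d s]], subst power2_commute, rule mult_right_mono[OF c1])
      (use s in \<open>auto intro!: add_nonneg_nonneg mult_nonneg_nonneg divide_nonneg_pos gsum_nonneg\<close>)
  have D2: "gsum N (\<lambda>i j. (w i j - w i (j + 1)) * conv N (\<lambda>k l. c k (l + 1) - c k l) d i j)
      \<le> B * h * (s / 2 * gsum N (\<lambda>i j. (w i (j + 1) - w i j)\<^sup>2) + ?D / (2 * s))"
    by (rule order_trans[OF conv_bound[OF d s]], subst power2_commute, rule mult_right_mono[OF c2])
      (use s in \<open>auto intro!: add_nonneg_nonneg mult_nonneg_nonneg divide_nonneg_pos gsum_nonneg\<close>)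
  have "- grad_inner N (conv N c d) w
      = gsum N (\<lambda>i j. (w i j - w (i + 1) j) * conv N (\<lambda>k l. c (k + 1) l - c k l) d i j)
      + gsum N (\<lambda>i j. (w i j - w i (j + 1)) * conv N (\<lambda>k l. c k (l + 1) - c k l) d i j)"
    unfolding conv_diff_kernel
    using conv_shift[OF c d, of _ 1 _ 0] conv_shift[OF c d, of _ 0 _ 1]
    by (simp add: grad_inner_def algebra_simps flip: gsum_add gsum_minus)
  also have "\<dots> \<le> B * h * (s / 2 * ?G + ?D / s)"
    using add_mono[OF D1 D2] by (simp add: grad_inner_self algebra_simps)
  also have "\<dots> = ?G + h\<^sup>2 * (B\<^sup>2 / 2 * ?D)"
    using B h by (simp add: s_def field_simps power2_eq_square)
  finally have "- grad_inner N (conv N c d) w / h\<^sup>2 \<le> (?G + h\<^sup>2 * (B\<^sup>2 / 2 * ?D)) / h\<^sup>2"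
    by (rule divide_right_mono) simp
  then have nonlocal: "k * gsum N (\<lambda>i j. conv N c d i j * d i j) \<le> ?G / h\<^sup>2 + B\<^sup>2 / 2 * ?D"
    using h unfolding cdd by (simp add: add_divide_distrib)
  \<comment> \<open>The cubic part of \<open>F'\<close> is monotone and its linear part costs
    exactly 1, which turns \<open>a\<close> into \<open>a - 1\<close>.\<close>
  have cube: "(p - q)\<^sup>2 * (a - 1) \<le> ((deriv pot p - deriv pot q) + a * (p - q)) * (p - q)" for p q
  proof -
    have "((deriv pot p - deriv pot q) + a * (p - q)) * (p - q) - (p - q)\<^sup>2 * (a - 1)
        = (p - q)\<^sup>2 * ((p + q / 2)\<^sup>2 + 3 / 4 * q\<^sup>2)"
      by (simp add: deriv_pot power2_eq_square power3_eq_cube field_simps)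
    also have "\<dots> \<ge> 0" by simp
    finally show ?thesis by simp
  qed
  have "gsum N (\<lambda>i j. (d i j)\<^sup>2 * (a - 1)) - gsum N (\<lambda>i j. conv N c d i j * d i j)
      \<le> gsum N (\<lambda>i j. w i j * d i j)"
    unfolding gsum_diff[symmetric] using cube
    by (intro gsum_mono) (simp add: w_def d_def left_diff_distrib)
  then have "k * (?D * (a - 1) - gsum N (\<lambda>i j. conv N c d i j * d i j)) \<le> - ?G / h\<^sup>2"
    unfolding gsum_multc dw[symmetric] using k by simp
  \<comment> \<open>Inserting \<open>nonlocal\<close> cancels the gradient term
    \<open>?G / h\<^sup>2\<close> on both sides.\<close>
  then have "(2 * k * (a - 1) - B\<^sup>2) * ?D \<le> 0"
    using nonlocal by (simp add: algebra_simps)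
  then have "?D \<le> 0" using small by (simp add: mult_le_0_iff)
  then show ?thesis
    using gsum_square_eq_0[OF d N] by (auto simp: d_def fun_eq_iff)
qed

section \<open>Existence of one step\<close>

definition energy :: "nat \<Rightarrow> real \<Rightarrow> grid_fun \<Rightarrow> grid_fun \<Rightarrow> real" where
  "energy N a c u = gsum N (\<lambda>i j. pot (u i j) + a / 2 * (u i j)\<^sup>2)
     - gsum N (\<lambda>i j. u i j * conv N c u i j) / 2"

text \<open>The convolution term is at most a multiple of the squared norm, by Young's inequality
  with weight 1, and the quartic potential dominates a quadratic term whatever the sign of its
  coefficient.\<close>

lemma energy_bounded_below: "\<exists>B. \<forall>u\<in>grid_functions N. - B \<le> energy N a c u"
proof -
  define K where "K = gsum N (\<lambda>k l. \<bar>c k l\<bar>)"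
  \<comment> \<open>\<open>b\<close> is the coefficient of \<open>r\<^sup>2\<close> once the
    potential is expanded; completing the square gives the bound.\<close>
  define b where "b = (a - K) / 2 - 1 / 2"
  have quartic: "- b\<^sup>2 \<le> pot r + a / 2 * r\<^sup>2 - K / 2 * r\<^sup>2" for r
  proof -
    have "pot r + a / 2 * r\<^sup>2 - K / 2 * r\<^sup>2 + b\<^sup>2 = (r\<^sup>2 / 2 + b)\<^sup>2 + 1 / 4"
      by (simp add: pot_def b_def power2_eq_square field_simps)
    also have "\<dots> \<ge> 0" by simp
    finally show ?thesis by simp
  qed
  have "- ((real N)\<^sup>2 * b\<^sup>2) \<le> energy N a c u" if u: "u \<in> grid_functions N" for u
  proof -
    have "gsum N (\<lambda>i j. u i j * conv N c u i j) \<le> K * gsum N (\<lambda>i j. (u i j)\<^sup>2)"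
      using conv_bound[OF u, of 1 u c] by (simp add: K_def)
    moreover have "gsum N (\<lambda>i j. - b\<^sup>2)
        \<le> gsum N (\<lambda>i j. pot (u i j) + a / 2 * (u i j)\<^sup>2 - K / 2 * (u i j)\<^sup>2)"
      by (intro gsum_mono quartic)
    ultimately show ?thesis
      unfolding energy_def gsum_const gsum_diff gsum_cmult by simp
  qed
  then show ?thesis by blast
qed

lemma gsum_has_derivative:
  assumes "\<And>i j. ((\<lambda>t. F t i j) has_real_derivative D i j) (at x)"
  shows "((\<lambda>t. gsum N (F t)) has_real_derivative gsum N D) (at x)"
  unfolding gsum_def by (intro DERIV_sum assms)

text \<open>The energy is differentiated along a line. Since the kernel is even, the two cross terms
  of its quadratic form coincide and cancel the factor 1/2.\<close>

lemma energy_has_derivative: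
  assumes c: "c \<in> grid_functions N" and even: "\<And>k l. c (- k) (- l) = c k l"
    and u: "u \<in> grid_functions N" and \<phi>: "\<phi> \<in> grid_functions N"
  shows "((\<lambda>t. energy N a c (\<lambda>i j. u i j + t * \<phi> i j)) has_real_derivative
    gsum N (\<lambda>i j. \<phi> i j * (deriv pot (u i j) + a * u i j - conv N c u i j))) (at 0)"
proof -
  have "((\<lambda>t. gsum N (\<lambda>i j. pot (u i j + t * \<phi> i j) + a / 2 * (u i j + t * \<phi> i j)\<^sup>2))
      has_real_derivative gsum N (\<lambda>i j. \<phi> i j * (deriv pot (u i j) + a * u i j))) (at 0)"
    by (rule gsum_has_derivative, unfold pot_def deriv_pot[unfolded pot_def])
      (auto intro!: derivative_eq_intros simp: power2_eq_square power3_eq_cube field_simps)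
  moreover have "gsum N (\<lambda>i j. (u i j + t * \<phi> i j) * conv N c (\<lambda>i j. u i j + t * \<phi> i j) i j)
     = gsum N (\<lambda>i j. u i j * conv N c u i j) + 2 * t * gsum N (\<lambda>i j. \<phi> i j * conv N c u i j)
     + t\<^sup>2 * gsum N (\<lambda>i j. \<phi> i j * conv N c \<phi> i j)" for t
  proof -
    have "gsum N (\<lambda>i j. (u i j + t * \<phi> i j) * conv N c (\<lambda>i j. u i j + t * \<phi> i j) i j)
     = gsum N (\<lambda>i j. u i j * conv N c u i j) + t * gsum N (\<lambda>i j. u i j * conv N c \<phi> i j)
     + t * gsum N (\<lambda>i j. \<phi> i j * conv N c u i j) + t\<^sup>2 * gsum N (\<lambda>i j. \<phi> i j * conv N c \<phi> i j)"
      unfolding conv_add_cmult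
      by (simp add: algebra_simps power2_eq_square flip: gsum_add gsum_cmult)
    then show ?thesis using conv_symmetric[OF c even u \<phi>] by simp
  qed
  moreover have "((\<lambda>t. (p + 2 * t * q + t\<^sup>2 * r) / 2) has_real_derivative q) (at 0)" for p q r :: real
    by (auto intro!: derivative_eq_intros)
  ultimately show ?thesis
    unfolding energy_def right_diff_distrib gsum_diff
    by (intro DERIV_diff) simp_all
qed

section \<open>Variation and coercivity of the gradient term\<close>

lemma dlaplace_add_cmult:
  "dlaplace h (\<lambda>i j. \<phi> i j + t * \<psi> i j) i j = dlaplace h \<phi> i j + t * dlaplace h \<psi> i j"
  by (simp add: dlaplace_def add_divide_distrib[symmetric] algebra_simps)

lemma grad_inner_commute: "grad_inner N \<phi> \<psi> = grad_inner N \<psi> \<phi>"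
  by (simp add: grad_inner_def mult.commute)

lemma grad_inner_perturb:
  "grad_inner N (\<lambda>i j. \<psi> i j + t * \<phi> i j) (\<lambda>i j. \<psi> i j + t * \<phi> i j)
    = grad_inner N \<psi> \<psi> + 2 * t * grad_inner N \<phi> \<psi> + t\<^sup>2 * grad_inner N \<phi> \<phi>"
  unfolding grad_inner_def gsum_add[symmetric] gsum_cmult[symmetric]
  by (simp add: algebra_simps power2_eq_square)

text \<open>A discrete Poincare inequality in the maximum norm: each single difference is at most
  \<open>sqrt Q\<close>, and a path from the origin, where \<open>\<psi>\<close> vanishes, reaches
  every cell modulo the period in fewer than \<open>2 * N\<close> steps.\<close>

lemma abs_le_of_grad_inner_le:
  assumes \<psi>: "\<psi> \<in> grid_functions N" and N: "N \<ge> 1" and "\<psi> 0 0 = 0" and Q: "grad_inner N \<psi> \<psi> \<le> Q"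
  shows "\<bar>\<psi> i j\<bar> \<le> 2 * real N * sqrt Q"
proof -
  have sq: "(\<lambda>i j. (\<psi> (i + 1) j - \<psi> i j)\<^sup>2) \<in> grid_functions N"
    "(\<lambda>i j. (\<psi> i (j + 1) - \<psi> i j)\<^sup>2) \<in> grid_functions N"
    using grid_functions_comp2[OF grid_functions_shift[OF \<psi>, of 1 0] \<psi>, of "\<lambda>x y. (x - y)\<^sup>2"]
      grid_functions_comp2[OF grid_functions_shift[OF \<psi>, of 0 1] \<psi>, of "\<lambda>x y. (x - y)\<^sup>2"]
    by simp_all
  have nonneg: "0 \<le> gsum N (\<lambda>i j. (\<psi> (i + 1) j - \<psi> i j)\<^sup>2)" "0 \<le> gsum N (\<lambda>i j. (\<psi> i (j + 1) - \<psi> i j)\<^sup>2)"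
    by (auto intro: gsum_nonneg)
  have d1: "\<bar>\<psi> (i + 1) j - \<psi> i j\<bar> \<le> sqrt Q" and d2: "\<bar>\<psi> i (j + 1) - \<psi> i j\<bar> \<le> sqrt Q" for i j
    using le_gsum[OF sq(1) N, of i j] le_gsum[OF sq(2) N, of i j] Q nonneg
    by (auto simp: grad_inner_self intro!: real_le_rsqrt)
  have e1: "\<bar>\<psi> (int n) 0\<bar> \<le> real n * sqrt Q" for n
  proof (induction n)
    case (Suc n)
    then show ?case using d1[of "int n" 0] by (simp add: algebra_simps)
  qed (use assms in simp)
  have e2: "\<bar>\<psi> (int n) (int m)\<bar> \<le> (real n + real m) * sqrt Q" for n m
  proof (induction m)
    case (Suc m)
    then show ?case using d2[of "int n" "int m"] by (simp add: algebra_simps)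
  qed (use e1 in simp)
  define n m where "n = nat (i mod int N)" and "m = nat (j mod int N)"
  have nm: "int n = i mod int N" "int m = j mod int N" "n < N" "m < N"
    using N by (auto simp: n_def m_def nat_less_iff)
  have "\<bar>\<psi> i j\<bar> \<le> (real n + real m) * sqrt Q"
    using e2[of n m] grid_function_mod[OF \<psi>, of i j] nm by simp
  also have "\<dots> \<le> (2 * real N) * sqrt Q"
  proof (rule mult_right_mono)
    \<comment> \<open>In HOL \<open>sqrt\<close> of a negative number is negative, so the sign has
      to be shown; here \<open>sqrt Q\<close> bounds an absolute value.\<close>
    show "0 \<le> sqrt Q" using d1[of 0 0] by linarith
  qed (use nm in simp)
  finally show ?thesis .
qed

section \<open>Compactness and continuity in the product topology\<close>

lemma continuous_on_grid_value: "continuous_on A (\<lambda>\<psi>::grid_fun. \<psi> i j)"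
proof -
  have "continuous_on A (\<lambda>\<psi>::grid_fun. \<psi> i)"
    by (rule continuous_on_product_then_coordinatewise[OF continuous_on_id])
  then show ?thesis by (rule continuous_on_product_then_coordinatewise)
qed

lemma compact_PiE_UNIV:
  fixes S :: "'b::topological_space set"
  assumes "compact S"
  shows "compact (PiE UNIV (\<lambda>_::'a. S))"
proof -
  have "compactin (product_topology (\<lambda>_. euclidean) UNIV) (PiE UNIV (\<lambda>_::'a. S))"
    using assms by (subst compactin_PiE) auto
  then show ?thesis by (simp add: euclidean_product_topology)
qed

text \<open>Grid functions are kept as functions on all integer pairs. Tychonoff's theorem makes the
  box compact, and periodicity and the value at the origin are closed conditions.\<close>

lemma compact_bounded_grid_functions:
  "compact {\<psi> \<in> grid_functions N. \<psi> 0 0 = 0 \<and> (\<forall>i j. \<bar>\<psi> i j\<bar> \<le> R)}"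
proof -
  have "closed {\<psi>::grid_fun. (\<forall>i j. \<psi> (i + int N) j = \<psi> i j \<and> \<psi> i (j + int N) = \<psi> i j) \<and> \<psi> 0 0 = 0}"
    by (intro closed_Collect_all closed_Collect_conj closed_Collect_eq
        continuous_on_grid_value continuous_on_const)
  then have "compact (PiE UNIV (\<lambda>_. PiE UNIV (\<lambda>_. {-R..R})) \<inter>
      {\<psi>::grid_fun. (\<forall>i j. \<psi> (i + int N) j = \<psi> i j \<and> \<psi> i (j + int N) = \<psi> i j) \<and> \<psi> 0 0 = 0})"
    by (intro compact_Int_closed compact_PiE_UNIV compact_Icc)
  moreover have "\<psi> \<in> PiE UNIV (\<lambda>_. PiE UNIV (\<lambda>_. {-R..R})) \<longleftrightarrow> (\<forall>i j. \<bar>\<psi> i j\<bar> \<le> R)" for \<psi> :: grid_fun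
  proof -
    have "x \<in> {-R..R} \<longleftrightarrow> \<bar>x\<bar> \<le> R" for x by auto
    then show ?thesis by (simp only: PiE_UNIV_domain Pi_iff UNIV_I simp_thms ball_UNIV)
  qed
  ultimately show ?thesis
    by (elim back_subst[of compact]) (simp only: set_eq_iff Int_iff mem_Collect_eq grid_functions_def; blast)
qed

lemma continuous_on_gsum [continuous_intros]:
  "(\<And>i j. continuous_on A (\<lambda>x. F x i j)) \<Longrightarrow> continuous_on A (\<lambda>x. gsum N (F x))"
  unfolding gsum_def by (intro continuous_intros)

text \<open>Direct method in the variable \<open>\<psi>\<close> with
  \<open>u = f + dlaplace h \<psi>\<close>. This keeps the sum of \<open>u\<close> equal to that of
  \<open>f\<close>, so no constraint remains and no inverse Laplacian has to be defined.\<close>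

lemma implicit_step_exists:
  fixes a k :: real
  assumes N: "N \<ge> 1" and h: "h > 0" and k: "k > 0"
    and c: "c \<in> grid_functions N" and even: "\<And>k l. c (- k) (- l) = c k l"
    and f: "f \<in> grid_functions N"
  shows "\<exists>u\<in>grid_functions N. \<forall>i j. k * (u i j - f i j)
    = dlaplace h (\<lambda>i j. deriv pot (u i j) + a * u i j - conv N c u i j) i j"
proof -
  define U where "U = (\<lambda>\<psi> i j. f i j + dlaplace h \<psi> i j)"
  define G where "G = (\<lambda>\<psi>. k / (2 * h\<^sup>2) * grad_inner N \<psi> \<psi> + energy N a c (U \<psi>))"
  have U: "U \<psi> \<in> grid_functions N" if "\<psi> \<in> grid_functions N" for \<psi>
    using f dlaplace_grid[OF that] by (simp add: U_def grid_functions_def)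
  obtain B where B: "\<And>u. u \<in> grid_functions N \<Longrightarrow> - B \<le> energy N a c u"
    using energy_bounded_below by blast
  \<comment> \<open>Solving \<open>G \<psi> \<le> G 0\<close> for the gradient term, with the energy
    bounded below by \<open>- B\<close>, gives this value.\<close>
  define Q where "Q = (G (\<lambda>i j. 0) + B) * (2 * h\<^sup>2) / k"
  have coercive: "grad_inner N \<psi> \<psi> \<le> Q" if "\<psi> \<in> grid_functions N" "G \<psi> \<le> G (\<lambda>i j. 0)" for \<psi>
  proof -
    have "k / (2 * h\<^sup>2) * grad_inner N \<psi> \<psi> \<le> G (\<lambda>i j. 0) + B"
      using that B[OF U] by (force simp: G_def)
    then show ?thesis using h k by (simp add: Q_def field_simps)
  qed
  define K where "K = {\<psi> \<in> grid_functions N. \<psi> 0 0 = 0 \<and> (\<forall>i j. \<bar>\<psi> i j\<bar> \<le> 2 * real N * sqrt Q)}"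
  have K: "\<psi> \<in> K" if "\<psi> \<in> grid_functions N" "\<psi> 0 0 = 0" "G \<psi> \<le> G (\<lambda>i j. 0)" for \<psi>
    using that abs_le_of_grad_inner_le[OF that(1) N that(2) coercive] by (simp add: K_def)
  have zero: "(\<lambda>i j. 0) \<in> K" by (rule K) (simp_all add: grid_functions_def)
  have "continuous_on K G"
    unfolding G_def grad_inner_def energy_def U_def pot_def conv_def dlaplace_def
    by (intro continuous_intros continuous_on_grid_value) (use h in auto)
  then obtain \<psi> where \<psi>K: "\<psi> \<in> K" and min: "\<And>\<phi>. \<phi> \<in> K \<Longrightarrow> G \<psi> \<le> G \<phi>"
    using continuous_attains_inf[of K G] zero
      compact_bounded_grid_functions[of N "2 * real N * sqrt Q", folded K_def]
    by auto
  have \<psi>: "\<psi> \<in> grid_functions N" using \<psi>K by (simp add: K_def)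
  \<comment> \<open>\<open>G\<close> does not see additive constants, so a competitor may be
    normalised to vanish at the origin. It then lies in \<open>K\<close> or has a larger value than
    the zero function, which is in \<open>K\<close>.\<close>
  have global: "G \<psi> \<le> G \<phi>" if \<phi>: "\<phi> \<in> grid_functions N" for \<phi>
  proof -
    let ?\<phi> = "\<lambda>i j. \<phi> i j - \<phi> 0 0"
    have "grad_inner N ?\<phi> ?\<phi> = grad_inner N \<phi> \<phi>"
      by (simp add: grad_inner_def)
    moreover have "dlaplace h ?\<phi> = dlaplace h \<phi>"
      by (simp add: dlaplace_def algebra_simps)
    ultimately have *: "G ?\<phi> = G \<phi>"
      by (simp only: G_def U_def)
    have "G \<psi> \<le> G ?\<phi>"
    proof (cases "G ?\<phi> \<le> G (\<lambda>i j. 0)")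
      case True
      have "?\<phi> \<in> grid_functions N" using \<phi> by (simp add: grid_functions_def)
      from K[OF this _ True] show ?thesis by (intro min) simp
    next
      case False
      with min[OF zero] show ?thesis by linarith
    qed
    then show ?thesis unfolding * .
  qed
  define W where "W = (\<lambda>i j. deriv pot (U \<psi> i j) + a * U \<psi> i j - conv N c (U \<psi>) i j)"
  have W: "W \<in> grid_functions N"
    using U[OF \<psi>] conv_grid[OF U[OF \<psi>], of c] by (simp add: W_def grid_functions_def)
  \<comment> \<open>The residual of the equation serves as its own direction of variation: the
    vanishing first variation then says that its squared norm is zero.\<close>
  define r where "r = (\<lambda>i j. dlaplace h W i j - k * dlaplace h \<psi> i j)"
  have r: "r \<in> grid_functions N"
    using dlaplace_grid[OF \<psi>, of h] dlaplace_grid[OF W, of h] by (simp add: r_def grid_functions_def)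
  have "((\<lambda>t. G (\<lambda>i j. \<psi> i j + t * r i j)) has_real_derivative
      k / (2 * h\<^sup>2) * (2 * grad_inner N r \<psi>) + gsum N (\<lambda>i j. dlaplace h r i j * W i j)) (at 0)"
    unfolding G_def
  proof (rule DERIV_add)
    show "((\<lambda>t. k / (2 * h\<^sup>2) * grad_inner N (\<lambda>i j. \<psi> i j + t * r i j) (\<lambda>i j. \<psi> i j + t * r i j))
      has_real_derivative k / (2 * h\<^sup>2) * (2 * grad_inner N r \<psi>)) (at 0)"
      unfolding grad_inner_perturb by (rule DERIV_cmult) (auto intro!: derivative_eq_intros)
    show "((\<lambda>t. energy N a c (U (\<lambda>i j. \<psi> i j + t * r i j)))
      has_real_derivative gsum N (\<lambda>i j. dlaplace h r i j * W i j)) (at 0)"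
      using energy_has_derivative[OF c even U[OF \<psi>] dlaplace_grid[OF r]]
      by (simp add: U_def W_def dlaplace_add_cmult add.assoc)
  qed
  then have "k / (2 * h\<^sup>2) * (2 * grad_inner N r \<psi>) + gsum N (\<lambda>i j. dlaplace h r i j * W i j) = 0"
  proof (rule DERIV_local_min[where d = 1])
    show "\<forall>y. \<bar>0 - y\<bar> < 1 \<longrightarrow> G (\<lambda>i j. \<psi> i j + 0 * r i j) \<le> G (\<lambda>i j. \<psi> i j + y * r i j)"
      using \<psi> r by (auto intro!: global simp: grid_functions_def)
  qed simp
  moreover have "gsum N (\<lambda>i j. dlaplace h r i j * W i j) = gsum N (\<lambda>i j. r i j * dlaplace h W i j)"
    using gsum_mult_dlaplace[OF W r, of h] gsum_mult_dlaplace[OF r W, of h]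
    by (simp add: mult.commute grad_inner_commute)
  moreover have "k / (2 * h\<^sup>2) * (2 * grad_inner N r \<psi>) = - (k * gsum N (\<lambda>i j. r i j * dlaplace h \<psi> i j))"
    unfolding gsum_mult_dlaplace[OF r \<psi>] using h by simp
  moreover have "gsum N (\<lambda>i j. (r i j)\<^sup>2)
      = gsum N (\<lambda>i j. r i j * dlaplace h W i j) - k * gsum N (\<lambda>i j. r i j * dlaplace h \<psi> i j)"
  proof -
    have "(r i j)\<^sup>2 = r i j * dlaplace h W i j - k * (r i j * dlaplace h \<psi> i j)" for i j
      by (simp add: r_def power2_eq_square right_diff_distrib mult.left_commute)
    then show ?thesis by (simp only: gsum_diff gsum_cmult)
  qed
  ultimately have "gsum N (\<lambda>i j. (r i j)\<^sup>2) = 0" by linarith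
  then have "r i j = 0" for i j
    by (intro gsum_square_eq_0[OF r N]) simp
  then have "k * (U \<psi> i j - f i j) = dlaplace h W i j" for i j
    by (simp add: r_def U_def)
  then show ?thesis using U[OF \<psi>] unfolding W_def by blast
qed

section \<open>The kernel\<close>

text \<open>The mean value theorem along the segment from \<open>p\<close> in direction
  \<open>v\<close>; the degenerate segment \<open>t = 0\<close> is split off.\<close>

lemma directional_increment_bound:
  fixes J :: "'a::real_normed_vector \<Rightarrow> real"
  assumes "\<And>x. J differentiable (at x)" and "t \<ge> 0"
    and M: "\<And>s. 0 \<le> s \<Longrightarrow> s \<le> t \<Longrightarrow> \<bar>frechet_derivative J (at (p + s *\<^sub>R v)) v\<bar> \<le> M"
  shows "\<bar>J (p + t *\<^sub>R v) - J p\<bar> \<le> M * t"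
proof (cases "t = 0")
  case False
  have "((\<lambda>s. J (p + s *\<^sub>R v)) has_real_derivative frechet_derivative J (at (p + s *\<^sub>R v)) v) (at s)" for s
  proof -
    have J: "(J has_derivative frechet_derivative J (at (p + s *\<^sub>R v))) (at (p + s *\<^sub>R v))"
      using assms(1) frechet_derivative_works by blast
    have "((\<lambda>s. p + s *\<^sub>R v) has_derivative (\<lambda>r. r *\<^sub>R v)) (at s)"
      by (auto intro!: derivative_eq_intros)
    from has_derivative_compose[OF this J]
    have "((\<lambda>s. J (p + s *\<^sub>R v)) has_derivative
        (\<lambda>r. frechet_derivative J (at (p + s *\<^sub>R v)) (r *\<^sub>R v))) (at s)" .
    then show ?thesis
      using linear_scale[OF has_derivative_linear[OF J]]
      by (simp add: has_field_derivative_def mult_commute_abs)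
  qed
  then obtain z where "0 < z" "z < t" and
    z: "J (p + t *\<^sub>R v) - J (p + 0 *\<^sub>R v) = (t - 0) * frechet_derivative J (at (p + z *\<^sub>R v)) v"
    using MVT2[of 0 t "\<lambda>s. J (p + s *\<^sub>R v)" "\<lambda>s. frechet_derivative J (at (p + s *\<^sub>R v)) v"]
      assms(2) False by auto
  then have "\<bar>J (p + t *\<^sub>R v) - J p\<bar> = t * \<bar>frechet_derivative J (at (p + z *\<^sub>R v)) v\<bar>"
    using assms(2) by (simp add: abs_mult)
  also have "\<dots> \<le> t * M" using \<open>0 < z\<close> \<open>z < t\<close> by (intro mult_left_mono M) auto
  finally show ?thesis by (simp add: mult.commute)
qed simp

lemma kernel_increment_bound:
  fixes J :: "real \<times> real \<Rightarrow> real"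
  assumes "C_infinity J"
  shows "\<exists>M>0. \<forall>x\<in>{0..L}. \<forall>y\<in>{0..L}. \<forall>t\<in>{0..L}.
    \<bar>J (x + t, y) - J (x, y)\<bar> \<le> M * t \<and> \<bar>J (x, y + t) - J (x, y)\<bar> \<le> M * t"
proof -
  have C1: "C_k (Suc 0) J" using assms by (simp only: C_infinity_def)
  then have diff: "J differentiable (at x)" for x by (simp only: C_k.simps)
  \<comment> \<open>Base points and increments both range up to \<open>L\<close>, so the segments
    stay in the square of side \<open>2 * L\<close>.\<close>
  have "\<exists>M. \<forall>p\<in>{0..2 * L} \<times> {0..2 * L}. \<bar>frechet_derivative J (at p) v\<bar> \<le> M" for v
  proof -
    have "continuous_on ({0..2 * L} \<times> {0..2 * L}) (\<lambda>p. frechet_derivative J (at p) v)"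
      using C1 unfolding C_k.simps by (blast intro: continuous_on_subset)
    from compact_continuous_image[OF this compact_Times[OF compact_Icc compact_Icc]]
    have "bounded ((\<lambda>p. frechet_derivative J (at p) v) ` ({0..2 * L} \<times> {0..2 * L}))"
      by (rule compact_imp_bounded)
    then show ?thesis by (simp add: bounded_iff)
  qed
  then obtain M where M: "\<And>v p. p \<in> {0..2 * L} \<times> {0..2 * L} \<Longrightarrow> \<bar>frechet_derivative J (at p) v\<bar> \<le> M v"
    by metis
  \<comment> \<open>The summand 1 keeps the constant positive even for a constant kernel.\<close>
  define M' where "M' = \<bar>M (1, 0)\<bar> + \<bar>M (0, 1)\<bar> + 1"
  have M': "M (1, 0) \<le> M'" "M (0, 1) \<le> M'" "M' > 0" by (auto simp: M'_def)
  show ?thesis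
  proof (intro exI[of _ M'] conjI ballI)
    fix x y t :: real
    assume "x \<in> {0..L}" "y \<in> {0..L}" "t \<in> {0..L}"
    then have *: "0 \<le> x" "x \<le> L" "0 \<le> y" "y \<le> L" "0 \<le> t" "t \<le> L" by simp_all
    have "\<bar>frechet_derivative J (at ((x, y) + s *\<^sub>R (1, 0))) (1, 0)\<bar> \<le> M'"
      "\<bar>frechet_derivative J (at ((x, y) + s *\<^sub>R (0, 1))) (0, 1)\<bar> \<le> M'"
      if "0 \<le> s" "s \<le> t" for s
      using M[of "(x + s, y)" "(1, 0)"] M[of "(x, y + s)" "(0, 1)"] M' that * by simp_all
    from directional_increment_bound[OF diff *(5) this(1)] directional_increment_bound[OF diff *(5) this(2)]
    show "\<bar>J (x + t, y) - J (x, y)\<bar> \<le> M' * t" "\<bar>J (x, y + t) - J (x, y)\<bar> \<le> M' * t"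
      by simp_all
  qed (rule M'(3))
qed

section \<open>The scheme\<close>

text \<open>The two implicit-step lemmas apply with \<open>B = \<epsilon>\<^sup>2 * A\<close>. As
  \<open>2 * k = 3 / \<tau>\<close> and \<open>a - 1 = gamma0 \<epsilon> h N J\<close>, the
  condition \<open>B\<^sup>2 < 2 * k * (a - 1)\<close> becomes \<open>small\<close>.\<close>

lemma BDF2_step_ex1:
  assumes N: "N \<ge> 1" and h: "h > 0" and \<tau>: "\<tau> > 0" and A: "A > 0"
    and per: "\<And>x y. J (x + real N * h, y) = J (x, y) \<and> J (x, y + real N * h) = J (x, y)"
    and even: "\<And>x. J (- x) = J x"
    and inc1: "\<And>k l. k \<in> {1..int N} \<Longrightarrow> l \<in> {1..int N} \<Longrightarrow>
      (real N * h)\<^sup>2 * \<bar>J (of_int k * h + h, of_int l * h) - J (of_int k * h, of_int l * h)\<bar> \<le> A * h"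
    and inc2: "\<And>k l. k \<in> {1..int N} \<Longrightarrow> l \<in> {1..int N} \<Longrightarrow>
      (real N * h)\<^sup>2 * \<bar>J (of_int k * h, of_int l * h + h) - J (of_int k * h, of_int l * h)\<bar> \<le> A * h"
    and \<epsilon>: "\<epsilon> > 0" and small: "A\<^sup>2 * \<epsilon> ^ 4 * \<tau> < 3 * gamma0 \<epsilon> h N J"
    and p: "p \<in> grid_functions N" and q: "q \<in> grid_functions N"
  shows "\<exists>!u. u \<in> grid_functions N \<and> (\<forall>i j. (3 * u i j - 4 * q i j + p i j) / (2 * \<tau>)
    = dlaplace h (\<lambda>i j. deriv pot (u i j) + \<epsilon>\<^sup>2 * dconv_one h N J * u i j - \<epsilon>\<^sup>2 * dconv h N J u i j) i j)"
proof -
  define c where "c = (\<lambda>k l. \<epsilon>\<^sup>2 * h\<^sup>2 * J (of_int k * h, of_int l * h))"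
  define f where "f = (\<lambda>i j. (4 * q i j - p i j) / 3)"
  define a where "a = \<epsilon>\<^sup>2 * dconv_one h N J"
  define k where "k = 3 / (2 * \<tau>)"
  have k: "k > 0" using \<tau> by (simp add: k_def)
  have f: "f \<in> grid_functions N" using p q by (simp add: f_def grid_functions_def)
  have c: "c \<in> grid_functions N"
    using per by (simp add: c_def grid_functions_def distrib_right)
  have c_even: "c (- k) (- l) = c k l" for k l
    using even[of "(of_int k * h, of_int l * h)"] by (simp add: c_def)
  have conv: "\<epsilon>\<^sup>2 * dconv h N J u i j = conv N c u i j" for u i j
    by (simp add: dconv_def conv_def c_def gsum_def sum_distrib_left mult.assoc)
  have eq: "(3 * u i j - 4 * q i j + p i j) / (2 * \<tau>) = k * (u i j - f i j)" for u :: grid_fun and i j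
    using \<tau> by (simp add: k_def f_def field_simps)
  have bound: "gsum N (\<lambda>k l. \<bar>c (k + m) (l + n) - c k l\<bar>) \<le> \<epsilon>\<^sup>2 * A * h"
    if inc: "\<And>k l. k \<in> {1..int N} \<Longrightarrow> l \<in> {1..int N} \<Longrightarrow> (real N * h)\<^sup>2 *
      \<bar>J (of_int k * h + of_int m * h, of_int l * h + of_int n * h) - J (of_int k * h, of_int l * h)\<bar> \<le> A * h"
    for m n
  proof -
    \<comment> \<open>The bound is distributed equally over the \<open>N\<^sup>2\<close> cells; the
      factor \<open>h\<^sup>2\<close> in \<open>c\<close> and this cell count combine to the area
      \<open>(N h)\<^sup>2\<close>.\<close>
    have "gsum N (\<lambda>k l. \<bar>c (k + m) (l + n) - c k l\<bar>) \<le> gsum N (\<lambda>k l. \<epsilon>\<^sup>2 * A * h / (real N)\<^sup>2)"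
    proof (rule gsum_mono)
      fix k l assume kl: "1 \<le> k" "k \<le> int N" "1 \<le> l" "l \<le> int N"
      define D where "D = J (of_int k * h + of_int m * h, of_int l * h + of_int n * h) - J (of_int k * h, of_int l * h)"
      have "c (k + m) (l + n) - c k l = \<epsilon>\<^sup>2 * h\<^sup>2 * D"
        by (simp add: c_def D_def distrib_right right_diff_distrib)
      then have "\<bar>c (k + m) (l + n) - c k l\<bar> * (real N)\<^sup>2 = \<epsilon>\<^sup>2 * ((real N * h)\<^sup>2 * \<bar>D\<bar>)"
        by (simp add: abs_mult power_mult_distrib)
      also have "\<dots> \<le> \<epsilon>\<^sup>2 * (A * h)"
        unfolding D_def using kl by (intro mult_left_mono inc) auto
      finally show "\<bar>c (k + m) (l + n) - c k l\<bar> \<le> \<epsilon>\<^sup>2 * A * h / (real N)\<^sup>2"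
        using N by (simp add: pos_le_divide_eq mult.assoc)
    qed
    then show ?thesis using N by (simp add: gsum_const)
  qed
  have c1: "gsum N (\<lambda>k l. \<bar>c (k + 1) l - c k l\<bar>) \<le> \<epsilon>\<^sup>2 * A * h"
    using bound[of 1 0] inc1 by simp
  have c2: "gsum N (\<lambda>k l. \<bar>c k (l + 1) - c k l\<bar>) \<le> \<epsilon>\<^sup>2 * A * h"
    using bound[of 0 1] inc2 by simp
  have small': "(\<epsilon>\<^sup>2 * A)\<^sup>2 < 2 * k * (a - 1)"
    using small \<tau> by (simp add: k_def a_def gamma0_def field_simps power_mult_distrib)
  have pos: "\<epsilon>\<^sup>2 * A > 0" using \<epsilon> A by simp
  let ?P = "\<lambda>u. \<forall>i j. k * (u i j - f i j) = dlaplace h (\<lambda>i j. deriv pot (u i j) + a * u i j - conv N c u i j) i j"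
  have "\<exists>u. u \<in> grid_functions N \<and> ?P u"
    using implicit_step_exists[OF N h k c c_even f, of a] by (simp only: Bex_def)
  moreover have "u = v" if "u \<in> grid_functions N \<and> ?P u" "v \<in> grid_functions N \<and> ?P v" for u v
    by (rule implicit_step_unique[OF N h pos k c c1 c2 small', where f = f]) (simp_all add: that)
  ultimately have "\<exists>!u. u \<in> grid_functions N \<and> ?P u" by (rule ex_ex1I)
  then show ?thesis unfolding eq conv a_def .
qed

text \<open>The area \<open>L\<^sup>2\<close> is multiplied into the increment bound here, which
  makes \<open>A\<close> uniform in \<open>N\<close>. The grid points and the mesh width lie in
  \<open>[0, L]\<close>, where the bound on increments holds.\<close>

lemma kernel_grid_increment_bound:
  assumes "L > 0" "periodic_kernel L J"
  obtains A where "A > 0"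
    and "\<And>N k l. N \<ge> 1 \<Longrightarrow> k \<in> {1..int N} \<Longrightarrow> l \<in> {1..int N} \<Longrightarrow>
      L\<^sup>2 * \<bar>J (of_int k * (L / N) + L / N, of_int l * (L / N)) - J (of_int k * (L / N), of_int l * (L / N))\<bar>
        \<le> A * (L / N)"
    and "\<And>N k l. N \<ge> 1 \<Longrightarrow> k \<in> {1..int N} \<Longrightarrow> l \<in> {1..int N} \<Longrightarrow>
      L\<^sup>2 * \<bar>J (of_int k * (L / N), of_int l * (L / N) + L / N) - J (of_int k * (L / N), of_int l * (L / N))\<bar>
        \<le> A * (L / N)"
proof -
  have "C_infinity J" using assms by (simp add: periodic_kernel_def)
  from kernel_increment_bound[OF this, of L] obtain M where "M > 0" and inc: "\<forall>x\<in>{0..L}. \<forall>y\<in>{0..L}. \<forall>t\<in>{0..L}.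
      \<bar>J (x + t, y) - J (x, y)\<bar> \<le> M * t \<and> \<bar>J (x, y + t) - J (x, y)\<bar> \<le> M * t"
    by blast
  have M: "\<bar>J (x + t, y) - J (x, y)\<bar> \<le> M * t" "\<bar>J (x, y + t) - J (x, y)\<bar> \<le> M * t"
    if "0 \<le> x" "x \<le> L" "0 \<le> y" "y \<le> L" "0 \<le> t" "t \<le> L" for x y t
    using inc[rule_format, of x y t] that by simp_all
  have range: "0 \<le> of_int k * (L / real N)" "of_int k * (L / real N) \<le> L"
    if "N \<ge> 1" "k \<in> {1..int N}" for N k
  proof -
    have "real_of_int k \<le> real N" using that(2) of_int_le_iff[of k "int N", where 'a = real] by simp
    then have "of_int k * (L / real N) \<le> real N * (L / real N)"
      using assms that by (intro mult_right_mono) auto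
    then show "of_int k * (L / real N) \<le> L" using that by simp
  qed (use that assms in simp)
  have step: "0 \<le> L / real N" "L / real N \<le> L" if "N \<ge> 1" for N
    using that assms range[of N 1] by simp_all
  show thesis
  proof (rule that[of "L\<^sup>2 * M"])
    show "L\<^sup>2 * M > 0" using assms \<open>M > 0\<close> by simp
    fix N :: nat and k l :: int
    assume *: "N \<ge> 1" "k \<in> {1..int N}" "l \<in> {1..int N}"
    show "L\<^sup>2 * \<bar>J (of_int k * (L / N) + L / N, of_int l * (L / N)) - J (of_int k * (L / N), of_int l * (L / N))\<bar>
        \<le> L\<^sup>2 * M * (L / N)"
      unfolding mult.assoc[of "L\<^sup>2"] by (rule mult_left_mono[OF M(1)[OF range[OF *(1,2)] range[OF *(1,3)] step[OF *(1)]]]) simp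
    show "L\<^sup>2 * \<bar>J (of_int k * (L / N), of_int l * (L / N) + L / N) - J (of_int k * (L / N), of_int l * (L / N))\<bar>
        \<le> L\<^sup>2 * M * (L / N)"
      unfolding mult.assoc[of "L\<^sup>2"] by (rule mult_left_mono[OF M(2)[OF range[OF *(1,2)] range[OF *(1,3)] step[OF *(1)]]]) simp
  qed
qed

theorem theorem4p1:
  fixes L :: real and J :: "real \<times> real \<Rightarrow> real"
  assumes "L > 0" and "periodic_kernel L J"
  shows "\<exists>C\<^sub>J>0. \<forall>(\<epsilon>::real) (N::nat) (h::real) (\<tau>::real) (u0::grid_fun) (u1::grid_fun).
    \<epsilon> > 0 \<longrightarrow> N \<ge> 1 \<longrightarrow> h = L / real N \<longrightarrow>
    gamma \<epsilon> L J > 0 \<longrightarrow> gamma0 \<epsilon> h N J > 0 \<longrightarrow>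
    u0 \<in> grid_functions N \<longrightarrow> u1 \<in> grid_functions N \<longrightarrow>
    grid_inner N u1 grid_one = grid_inner N u0 grid_one \<longrightarrow>
    \<tau> > 0 \<longrightarrow> \<tau> \<le> 2 * gamma0 \<epsilon> h N J / (C\<^sub>J * \<epsilon> ^ 4) \<longrightarrow>
    (\<exists>u \<omega>. BDF2_solution h N J \<epsilon> \<tau> u0 u1 u \<omega> \<and>
       (\<forall>u' \<omega>'. BDF2_solution h N J \<epsilon> \<tau> u0 u1 u' \<omega>' \<longrightarrow>
          u' = u \<and> (\<forall>n\<ge>2. \<omega>' n = \<omega> n)))"
proof -
  obtain A where A: "A > 0"
    and inc: "\<And>N k l. N \<ge> 1 \<Longrightarrow> k \<in> {1..int N} \<Longrightarrow> l \<in> {1..int N} \<Longrightarrow>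
      L\<^sup>2 * \<bar>J (of_int k * (L / N) + L / N, of_int l * (L / N)) - J (of_int k * (L / N), of_int l * (L / N))\<bar>
        \<le> A * (L / N)"
      "\<And>N k l. N \<ge> 1 \<Longrightarrow> k \<in> {1..int N} \<Longrightarrow> l \<in> {1..int N} \<Longrightarrow>
      L\<^sup>2 * \<bar>J (of_int k * (L / N), of_int l * (L / N) + L / N) - J (of_int k * (L / N), of_int l * (L / N))\<bar>
        \<le> A * (L / N)"
    using kernel_grid_increment_bound[OF assms] by blast
  show ?thesis
  \<comment> \<open>\<open>A\<close> depends on \<open>J\<close> and \<open>L\<close> alone and
    enters the step condition through its square.\<close>
  proof (rule exI[of _ "A\<^sup>2"], intro conjI allI impI)
    show "A\<^sup>2 > 0" using A by simp
    fix \<epsilon> :: real and N :: nat and h \<tau> :: real and u0 u1 :: grid_fun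
    assume \<epsilon>: "\<epsilon> > 0" and N: "N \<ge> 1" and h: "h = L / real N" and \<gamma>: "gamma0 \<epsilon> h N J > 0"
      and u0: "u0 \<in> grid_functions N" and u1: "u1 \<in> grid_functions N"
      and \<tau>: "\<tau> > 0" "\<tau> \<le> 2 * gamma0 \<epsilon> h N J / (A\<^sup>2 * \<epsilon> ^ 4)"
    have Nh: "real N * h = L" using N h by simp
    have "A\<^sup>2 * \<epsilon> ^ 4 * \<tau> \<le> 2 * gamma0 \<epsilon> h N J"
      using \<tau> A \<epsilon> by (simp add: pos_le_divide_eq mult.commute)
    \<comment> \<open>The time step restriction carries the factor 2 where uniqueness tolerates 3,
      so positivity of \<open>gamma0\<close> yields the strict inequality.\<close>
    then have small: "A\<^sup>2 * \<epsilon> ^ 4 * \<tau> < 3 * gamma0 \<epsilon> h N J" using \<gamma> by simp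
    define W where "W = (\<lambda>u i j. deriv pot (u i j) + \<epsilon>\<^sup>2 * dconv_one h N J * u i j - \<epsilon>\<^sup>2 * dconv h N J u i j)"
    define S where "S = (\<lambda>p q u. u \<in> grid_functions N \<and>
      (\<forall>i j. (3 * u i j - 4 * q i j + p i j) / (2 * \<tau>) = dlaplace h (W u) i j))"
    have ex1: "\<exists>!u. S p q u" if "p \<in> grid_functions N" "q \<in> grid_functions N" for p q
      unfolding S_def W_def
    proof (rule BDF2_step_ex1[OF N _ \<tau>(1) A _ _ _ _ \<epsilon> small that])
      show "h > 0" using h N assms by simp
    qed (use inc[OF N] assms in \<open>auto simp: periodic_kernel_def Nh simp flip: h\<close>)
    have W: "W u \<in> grid_functions N" if "u \<in> grid_functions N" for u
    proof -
      have "dconv h N J u = (\<lambda>i j. h\<^sup>2 * conv N (\<lambda>k l. J (of_int k * h, of_int l * h)) u i j)"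
        by (simp add: dconv_def conv_def gsum_def)
      then show ?thesis
        using that conv_grid[OF that] by (simp add: W_def grid_functions_def)
    qed
    \<comment> \<open>The recursion has two steps, so it runs on pairs of consecutive
      iterates.\<close>
    define v where "v = rec_nat (u0, u1) (\<lambda>_ (p, q). (q, THE u. S p q u))"
    define u where "u = (\<lambda>n. fst (v n))"
    have snd_v: "snd (v n) = u (Suc n)" for n
      by (simp add: u_def v_def split: prod.split)
    have u_rec: "u (Suc (Suc n)) = (THE w. S (u n) (u (Suc n)) w)" for n
      by (simp add: snd_v[symmetric]) (simp add: u_def v_def split: prod.split)
    have u_init: "u 0 = u0" "u (Suc 0) = u1"
      by (simp_all add: u_def v_def)
    have "u n \<in> grid_functions N \<and> u (Suc n) \<in> grid_functions N" for n
    proof (induction n)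
      case 0
      show ?case using u0 u1 by (simp add: u_init)
    next
      case (Suc n)
      then have "S (u n) (u (Suc n)) (u (Suc (Suc n)))"
        unfolding u_rec by (intro theI'[OF ex1]) simp_all
      then show ?case using Suc by (simp add: S_def)
    qed
    then have u: "u n \<in> grid_functions N" for n by blast
    have S: "S (u n) (u (Suc n)) (u (Suc (Suc n)))" for n
      unfolding u_rec by (rule theI'[OF ex1[OF u u]])
    \<comment> \<open>Eliminating \<open>\<omega>\<close> and shifting the index by one turns the
      scheme into the relation \<open>S\<close> between three consecutive iterates;
      \<open>\<omega>\<close> is periodic because \<open>W\<close> preserves periodicity.\<close>
    have BDF2: "BDF2_solution h N J \<epsilon> \<tau> u0 u1 x \<omega> \<longleftrightarrow> x 0 = u0 \<and> x (Suc 0) = u1 \<and>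
        (\<forall>n. S (x n) (x (Suc n)) (x (Suc (Suc n))) \<and> \<omega> (Suc (Suc n)) = W (x (Suc (Suc n))))" for x \<omega>
    proof -
      have all_ge: "(\<forall>n\<ge>1. P n) \<longleftrightarrow> (\<forall>n. P (Suc n))" for P :: "nat \<Rightarrow> bool"
        by (auto simp: Suc_le_eq gr0_conv_Suc)
      have W_fold: "deriv pot (y i j) + \<epsilon>\<^sup>2 * dconv_one h N J * y i j - \<epsilon>\<^sup>2 * dconv h N J y i j = W y i j" for y i j
        by (simp add: W_def)
      have W_eq: "(\<forall>i j. g i j = W y i j) \<longleftrightarrow> g = W y" for g y
        by (simp add: fun_eq_iff)
      show ?thesis
        unfolding BDF2_solution_def all_ge W_fold W_eq S_def using W by auto
    qed
    show "\<exists>u \<omega>. BDF2_solution h N J \<epsilon> \<tau> u0 u1 u \<omega> \<and>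
       (\<forall>u' \<omega>'. BDF2_solution h N J \<epsilon> \<tau> u0 u1 u' \<omega>' \<longrightarrow>
          u' = u \<and> (\<forall>n\<ge>2. \<omega>' n = \<omega> n))"
    proof (intro exI conjI allI impI)
      \<comment> \<open>The values of this witness at 0 and 1 are arbitrary choices, since the
        scheme starts at index 2.\<close>
      show "BDF2_solution h N J \<epsilon> \<tau> u0 u1 u (\<lambda>n. W (u n))"
        using S by (simp add: BDF2 u_init)
      fix x \<omega> assume "BDF2_solution h N J \<epsilon> \<tau> u0 u1 x \<omega>"
      then have x: "x 0 = u0" "x (Suc 0) = u1" "\<And>n. S (x n) (x (Suc n)) (x (Suc (Suc n)))"
        and \<omega>: "\<And>n. \<omega> (Suc (Suc n)) = W (x (Suc (Suc n)))"
        by (auto simp: BDF2)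
      \<comment> \<open>The induction carries two consecutive iterates, since each step reads
        both.\<close>
      have "x n = u n \<and> x (Suc n) = u (Suc n)" for n
      proof (induction n)
        case (Suc n)
        then show ?case using ex1[OF u u] S[of n] x(3)[of n] by (metis (no_types))
      qed (simp add: x u_init)
      then show xu: "x = u" by (intro ext) simp
      show "\<omega> n = W (u n)" if "n \<ge> 2" for n
      proof -
        obtain m where "n = 2 + m" using le_Suc_ex[OF \<open>n \<ge> 2\<close>] by blast
        then show ?thesis using \<omega>[of m] xu by simp
      qed
    qed
  qed
qed

end
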